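(* The following two identities form a basis for the variety of commutative BCK-algebras, regarded as algebras $(A,\rightarrow)$ of type $\langle 2\rangle$: $$(x \rightarrow x) \rightarrow y = y \tag{C1}$$ $$(x \rightarrow y) \rightarrow (z \rightarrow y) = (y \rightarrow x) \rightarrow (z \rightarrow x). \tag{C2}$$ That is: an algebra $(A,\rightarrow)$ with one binary operation (with $A$ nonempty) is a commutative BCK-algebra if and only if it satisfies (C1) for all $x,y\in A$ and (C2) for all $x,y,z\in A$; moreover the two identities are independent, i.e. there is an algebra of type $\langle 2\rangle$ satisfying (C1) but not (C2), and one satisfying (C2) but not (C1).
   Context: All algebras have nonempty carrier. A commutative BCK-algebra (with constant) is an algebra $(A,\rightarrow,1)$ of type $\langle 2,0\rangle$ satisfying, for all $x,y,z\in A$: (B1) $(x\rightarrow y)\rightarrow y = (y\rightarrow x)\rightarrow x$; (B2) $x\rightarrow (y\rightarrow z) = y\rightarrow (x\rightarrow z)$; (B3) $x\rightarrow x = 1$; (B4) $1\rightarrow x = x$. By (B3) the constant $1$ is determined by $\rightarrow$ and may be dropped from the signature: an algebra $(A,\rightarrow)$ of type $\langle 2\rangle$ is called a commutative BCK-algebra if it satisfies (B1), (B2), $x\rightarrow x = y\rightarrow y$, and $(x\rightarrow x)\rightarrow y = y$ for all $x,y,z\in A$ (equivalently, there is an element $1\in A$ such that $(A,\rightarrow,1)$ satisfies (B1)--(B4)). A set of identities is a basis for a variety if the identities are independent (no one of them follows from the others) and the algebras of the given type satisfying all of them are exactly the members of the variety. *)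

theory Defs
  imports Main
begin

locale binary_algebra =
  fixes A :: "'a set" and imp :: "'a \<Rightarrow> 'a \<Rightarrow> 'a" (infixr "\<rightarrow>" 65)
  assumes nonempty: "A \<noteq> {}"
    and closed: "\<lbrakk>x \<in> A; y \<in> A\<rbrakk> \<Longrightarrow> x \<rightarrow> y \<in> A"

locale comm_bck_algebra = binary_algebra +
  assumes B1: "\<lbrakk>x \<in> A; y \<in> A\<rbrakk> \<Longrightarrow> (x \<rightarrow> y) \<rightarrow> y = (y \<rightarrow> x) \<rightarrow> x"
    and B2: "\<lbrakk>x \<in> A; y \<in> A; z \<in> A\<rbrakk> \<Longrightarrow> x \<rightarrow> (y \<rightarrow> z) = y \<rightarrow> (x \<rightarrow> z)"
    and B3: "\<lbrakk>x \<in> A; y \<in> A\<rbrakk> \<Longrightarrow> x \<rightarrow> x = y \<rightarrow> y"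
    and B4: "\<lbrakk>x \<in> A; y \<in> A\<rbrakk> \<Longrightarrow> (x \<rightarrow> x) \<rightarrow> y = y"

locale comm_bck_algebra_with_constant = binary_algebra +
  fixes one :: 'a (\<open>\<one>\<close>)
  assumes one_closed: "\<one> \<in> A"
    and B1: "\<lbrakk>x \<in> A; y \<in> A\<rbrakk> \<Longrightarrow> (x \<rightarrow> y) \<rightarrow> y = (y \<rightarrow> x) \<rightarrow> x"
    and B2: "\<lbrakk>x \<in> A; y \<in> A; z \<in> A\<rbrakk> \<Longrightarrow> x \<rightarrow> (y \<rightarrow> z) = y \<rightarrow> (x \<rightarrow> z)"
    and B3: "x \<in> A \<Longrightarrow> x \<rightarrow> x = \<one>"
    and B4: "x \<in> A \<Longrightarrow> \<one> \<rightarrow> x = x"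

lemma comm_bck_algebra_iff_ex_constant:
  "comm_bck_algebra A imp \<longleftrightarrow> (\<exists>e. comm_bck_algebra_with_constant A imp e)"
proof
  assume "comm_bck_algebra A imp"
  then interpret comm_bck_algebra A imp .
  obtain a where a: "a \<in> A" using nonempty by blast
  have "comm_bck_algebra_with_constant A imp (imp a a)"
    by unfold_locales (use a closed B1 B2 B3 B4 in blast)+
  then show "\<exists>e. comm_bck_algebra_with_constant A imp e" ..
next
  assume "\<exists>e. comm_bck_algebra_with_constant A imp e"
  then obtain e where "comm_bck_algebra_with_constant A imp e" ..
  then interpret comm_bck_algebra_with_constant A imp e .
  show "comm_bck_algebra A imp"
    by unfold_locales (simp_all add: B1 B2 B3 B4)
qed

context
  fixes A :: "'a set" and imp :: "'a \<Rightarrow> 'a \<Rightarrow> 'a" (infixr "\<rightarrow>" 65)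
begin

definition satisfies_C1 :: bool where
  "satisfies_C1 \<longleftrightarrow> (\<forall>x\<in>A. \<forall>y\<in>A. (x \<rightarrow> x) \<rightarrow> y = y)"

definition satisfies_C2 :: bool where
  "satisfies_C2 \<longleftrightarrow>
    (\<forall>x\<in>A. \<forall>y\<in>A. \<forall>z\<in>A. (x \<rightarrow> y) \<rightarrow> (z \<rightarrow> y) = (y \<rightarrow> x) \<rightarrow> (z \<rightarrow> x))"

end

end

theory Submission
  imports Defs
begin

text \<open>
  Given (B2), identity (C2) is (B1) with \<open>z \<rightarrow> _\<close> applied to both sides. Conversely, (C1) makes
  every \<open>x \<rightarrow> x\<close> a left unit, and (C2) at a left unit \<open>z\<close> is (B1), which forces all left units
  \<open>x \<rightarrow> x\<close> to coincide. Once \<open>y \<rightarrow> (z \<rightarrow> y)\<close> is known to be the unit, put \<open>p = x \<rightarrow> z\<close> and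
  \<open>q = y \<rightarrow> z\<close>; then (C2) gives \<open>x \<rightarrow> q = (q \<rightarrow> z) \<rightarrow> p\<close>, and this is symmetric in \<open>p\<close> and \<open>q\<close>
  because \<open>p = (p \<rightarrow> z) \<rightarrow> z\<close>.
\<close>

context comm_bck_algebra
begin

lemma satisfies_C1: "satisfies_C1 A imp"
  unfolding satisfies_C1_def using B4 by blast

lemma satisfies_C2: "satisfies_C2 A imp"
  unfolding satisfies_C2_def
proof (intro ballI)
  fix x y z assume A: "x \<in> A" "y \<in> A" "z \<in> A"
  have "(x \<rightarrow> y) \<rightarrow> z \<rightarrow> y = z \<rightarrow> (x \<rightarrow> y) \<rightarrow> y"
    using A closed B2 by blast
  also have "\<dots> = z \<rightarrow> (y \<rightarrow> x) \<rightarrow> x"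
    using A B1 by simp
  also have "\<dots> = (y \<rightarrow> x) \<rightarrow> z \<rightarrow> x"
    using A closed B2 by blast
  finally show "(x \<rightarrow> y) \<rightarrow> z \<rightarrow> y = (y \<rightarrow> x) \<rightarrow> z \<rightarrow> x" .
qed

end

context binary_algebra
begin

lemma comm_bck_algebraI:
  assumes "satisfies_C1 A imp" and "satisfies_C2 A imp"
  shows "comm_bck_algebra A imp"
proof -
  have C1: "(x \<rightarrow> x) \<rightarrow> y = y" if "x \<in> A" "y \<in> A" for x y
    using assms(1) that unfolding satisfies_C1_def by blast
  have C2: "(x \<rightarrow> y) \<rightarrow> z \<rightarrow> y = (y \<rightarrow> x) \<rightarrow> z \<rightarrow> x" if "x \<in> A" "y \<in> A" "z \<in> A" for x y z
    using assms(2) that unfolding satisfies_C2_def by blast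
  have B1: "(x \<rightarrow> y) \<rightarrow> y = (y \<rightarrow> x) \<rightarrow> x" if "x \<in> A" "y \<in> A" for x y
    using C2[of x y "x \<rightarrow> x"] that by (simp add: C1 closed)
  have B3: "x \<rightarrow> x = y \<rightarrow> y" if "x \<in> A" "y \<in> A" for x y
    using B1[of "x \<rightarrow> x" "y \<rightarrow> y"] that by (simp add: C1 closed)
  obtain a where "a \<in> A" using nonempty by blast
  define e where "e = a \<rightarrow> a"
  have e: "e \<in> A" "x \<rightarrow> x = e" "e \<rightarrow> x = x" if "x \<in> A" for x
    unfolding e_def using \<open>a \<in> A\<close> that by (auto simp: closed C1 intro: B3)
  have C2_unit: "x \<rightarrow> z \<rightarrow> x = (x \<rightarrow> e) \<rightarrow> z \<rightarrow> e" if "x \<in> A" "z \<in> A" for x z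
    using C2[of e x z] that by (simp add: e)
  \<comment> \<open>At \<open>z = x\<close>, the left side of \<open>C2_unit\<close> is
    \<open>x \<rightarrow> e\<close>, and the right side has the form
    \<open>u \<rightarrow> u\<close>, which is \<open>e\<close>.\<close>
  have top: "x \<rightarrow> e = e" if "x \<in> A" for x
    using C2_unit[of x x] B1[of x e] that by (simp add: e closed)
  have weaken: "x \<rightarrow> z \<rightarrow> x = e" if "x \<in> A" "z \<in> A" for x z
    using C2_unit[of x z] that by (simp add: top e)
  have B2: "x \<rightarrow> y \<rightarrow> z = y \<rightarrow> x \<rightarrow> z" if A: "x \<in> A" "y \<in> A" "z \<in> A" for x y z
  proof -
    \<comment> \<open>In this instance of (C2) the left factor
      \<open>z \<rightarrow> v \<rightarrow> z\<close> is the unit by \<open>weaken\<close> and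
      drops out.\<close>
    have unfold: "u \<rightarrow> v \<rightarrow> z = ((v \<rightarrow> z) \<rightarrow> z) \<rightarrow> u \<rightarrow> z" if "u \<in> A" "v \<in> A" for u v
      using C2[of z "v \<rightarrow> z" u] that A by (simp add: weaken e closed)
    have absorb: "((x \<rightarrow> z) \<rightarrow> z) \<rightarrow> z = x \<rightarrow> z"
      using B1[of "x \<rightarrow> z" z] A by (simp add: weaken e closed)
    have "x \<rightarrow> y \<rightarrow> z = ((y \<rightarrow> z) \<rightarrow> z) \<rightarrow> ((x \<rightarrow> z) \<rightarrow> z) \<rightarrow> z"
      using unfold A by (simp add: absorb)
    \<comment> \<open>(C2) for the pair \<open>y \<rightarrow> z\<close> and \<open>z\<close>, with
      \<open>(x \<rightarrow> z) \<rightarrow> z\<close> as third element; the first factor is again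
      the unit, and the rest is \<open>unfold\<close> read backwards.\<close>
    also have "\<dots> = (z \<rightarrow> y \<rightarrow> z) \<rightarrow> ((x \<rightarrow> z) \<rightarrow> z) \<rightarrow> y \<rightarrow> z"
      using A by (intro C2 closed)
    also have "\<dots> = y \<rightarrow> x \<rightarrow> z"
      using A unfold[of y x] by (simp add: weaken e closed)
    finally show ?thesis .
  qed
  show ?thesis
    by unfold_locales (use B1 B2 B3 C1 in blast)+
qed

lemma comm_bck_algebra_iff:
  "comm_bck_algebra A imp \<longleftrightarrow> satisfies_C1 A imp \<and> satisfies_C2 A imp"
  using comm_bck_algebraI comm_bck_algebra.satisfies_C1 comm_bck_algebra.satisfies_C2 by blast

end

text \<open>Every element is a left unit here, but the two sides of (C2) evaluate to
  \<open>y\<close> and \<open>x\<close>.\<close>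

lemma right_projection_C1_not_C2:
  "binary_algebra {0, 1 :: nat} (\<lambda>x y. y)"
  "satisfies_C1 {0, 1 :: nat} (\<lambda>x y. y)"
  "\<not> satisfies_C2 {0, 1 :: nat} (\<lambda>x y. y)"
  by (auto simp: binary_algebra_def satisfies_C1_def satisfies_C2_def)

text \<open>Both sides of (C2) take the only value 0, whereas (C1) fails at
  \<open>y = 1\<close>.\<close>

lemma constant_C2_not_C1:
  "binary_algebra {0, 1 :: nat} (\<lambda>x y. 0)"
  "satisfies_C2 {0, 1 :: nat} (\<lambda>x y. 0)"
  "\<not> satisfies_C1 {0, 1 :: nat} (\<lambda>x y. 0)"
  by (auto simp: binary_algebra_def satisfies_C1_def satisfies_C2_def)

theorem theorem1p2:
  shows "(\<forall>(A :: 'a set) imp. binary_algebra A imp \<longrightarrow>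
            (comm_bck_algebra A imp \<longleftrightarrow> satisfies_C1 A imp \<and> satisfies_C2 A imp)) \<and>
         (\<exists>(A :: nat set) imp. binary_algebra A imp \<and> satisfies_C1 A imp \<and> \<not> satisfies_C2 A imp) \<and>
         (\<exists>(A :: nat set) imp. binary_algebra A imp \<and> satisfies_C2 A imp \<and> \<not> satisfies_C1 A imp)"
  using binary_algebra.comm_bck_algebra_iff right_projection_C1_not_C2 constant_C2_not_C1 by blast

end
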